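(* Let $t\mapsto(p_n)(t)$, $t\in\mathbb{R}$, be a smooth curve in $\Delta$ with initial data $(p_n)(0)=(p_n)_0\in\Delta$ and $(\dot p_n)(0)=(\dot p_n)_0\in T_{(p_n)_0}\Delta$. Then $t\mapsto(p_n)(t)$ is an $e$-geodesic of $(\Delta,\nabla^{(e)})$ if and only if there exists $\lambda\in\mathbb{R}$ such that, for the sequence $(a_n)$ defined by $$a_n:=\frac{\dot p_n(0)}{p_n(0)}+\lambda\qquad\forall n\in\mathbb{N},$$ the curve is of the form $$p_n(t)=\frac{p_n(0)e^{a_nt}}{\sum_{k=0}^{\infty}p_k(0)e^{a_kt}}\qquad\forall n\in\mathbb{N},\ \forall t\in\mathbb{R}.$$ Consequently, $(\Delta,\nabla^{(e)})$ is geodesically complete, i.e. $e$-geodesics exist globally in time, for all $t\in\mathbb{R}$.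
   Context: $\ell^2_{\mathbb{R}}$ is the real Hilbert space of square-summable real sequences $(x_n)_{n\in\mathbb{N}}$ (indices start at $0$); $\mathbb{S}(\ell^2_{\mathbb{R}})$ is its unit sphere and $\mathcal{U}:=\{(x_n)\in\mathbb{S}(\ell^2_{\mathbb{R}}):x_n>0\ \forall n\in\mathbb{N}\}$, with the differentiable structure and tangent spaces inherited from the sphere. The $\ell^2$-probability simplex is $\Delta:=\{(p_n)\in\ell^1_{\mathbb{R}}:\sum_{n\ge0}p_n=1,\ p_n>0\ \forall n\}$. It is equipped with the differentiable structure for which the bijection $\Phi:\Delta\to\mathcal{U}$, $(p_n)\mapsto(\sqrt{p_n})$, is a diffeomorphism. With respect to it, $$T_{(p_n)}\Delta=\Big\{(v_n)\in\ell^1_{\mathbb{R}}:\sum_{n\ge0}v_n=0,\ \Big(\tfrac{v_n}{\sqrt{p_n}}\Big)\in\ell^2_{\mathbb{R}}\Big\}.$$ The $e$-connection $\nabla^{(e)}$ on $\Delta$ is defined for vector fields $(V_n),(W_n)$ on $\Delta$ by $$\big(\nabla^{(e)}_{(V_n)}(W_n)\big)_n\Big|_{(p_n)}:=p_n\left(D_{(V_n)}\Big(\frac{W_n}{p_n}\Big)-\sum_{k=0}^{\infty}p_k\,D_{(V_n)}\Big(\frac{W_k}{p_k}\Big)\right)\Bigg|_{(p_n)},$$ where $D_{(V_n)}$ is the directional derivative along $(V_n)$. A smooth curve $t\mapsto(p_n)(t)$ in $\Delta$ defined on an interval is an $e$-geodesic if $\nabla^{(e)}_{(\dot p_n)}(\dot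 p_n)=0$, where along the curve $$\big(\nabla^{(e)}_{\dot p}\dot p\big)_n=p_n\left(\frac{d}{dt}\Big(\frac{\dot p_n}{p_n}\Big)-\sum_{k=0}^{\infty}p_k\frac{d}{dt}\Big(\frac{\dot p_k}{p_k}\Big)\right).$$
   Formalization: Geodesic completeness is false as stated (p_n=2^{-(n+1)}, v_n=(n-1)p_n has no e-geodesic past t=ln 2); instead: an e-geodesic on all of R with data (p,v) exists iff the sum of p_k e^{t v_k/p_k} converges for every t. Convergence of the denominator is made explicit. *)

theory Defs
  imports "HOL-Analysis.Analysis"
begin

section \<open>The real Hilbert space of square-summable sequences\<close>

typedef ell2 = "{x :: nat \<Rightarrow> real. summable (\<lambda>n. (x n)\<^sup>2)}"
  morphisms seq_of Abs_ell2
  by (rule exI[of _ "\<lambda>_. 0"]) simp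

setup_lifting type_definition_ell2

lemma summable_sq_add:
  fixes x y :: "nat \<Rightarrow> real"
  assumes "summable (\<lambda>n. (x n)\<^sup>2)" "summable (\<lambda>n. (y n)\<^sup>2)"
  shows "summable (\<lambda>n. (x n + y n)\<^sup>2)"
proof (rule summable_comparison_test)
  show "summable (\<lambda>n. 2 * (x n)\<^sup>2 + 2 * (y n)\<^sup>2)"
    using assms by (intro summable_add summable_mult)
  have "(x n + y n)\<^sup>2 \<le> 2 * (x n)\<^sup>2 + 2 * (y n)\<^sup>2" for n
    using zero_le_power2[of "x n - y n"] by (simp add: power2_sum power2_diff)
  then show "\<exists>N. \<forall>n\<ge>N. norm ((x n + y n)\<^sup>2) \<le> 2 * (x n)\<^sup>2 + 2 * (y n)\<^sup>2"
    by simp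
qed

lemma summable_sq_scale:
  fixes x :: "nat \<Rightarrow> real"
  shows "summable (\<lambda>n. (x n)\<^sup>2) \<Longrightarrow> summable (\<lambda>n. (c * x n)\<^sup>2)"
  by (simp add: power_mult_distrib summable_mult)

lemma summable_prod:
  fixes x y :: "nat \<Rightarrow> real"
  assumes "summable (\<lambda>n. (x n)\<^sup>2)" "summable (\<lambda>n. (y n)\<^sup>2)"
  shows "summable (\<lambda>n. x n * y n)"
proof (rule summable_comparison_test)
  show "summable (\<lambda>n. (x n)\<^sup>2 + (y n)\<^sup>2)"
    using assms by (intro summable_add)
  have "norm (x n * y n) \<le> (x n)\<^sup>2 + (y n)\<^sup>2" for n
  proof -
    have "2 * (\<bar>x n\<bar> * \<bar>y n\<bar>) \<le> (x n)\<^sup>2 + (y n)\<^sup>2"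
      using zero_le_power2[of "\<bar>x n\<bar> - \<bar>y n\<bar>"] by (simp add: power2_diff)
    moreover have "0 \<le> \<bar>x n\<bar> * \<bar>y n\<bar>" by simp
    ultimately show ?thesis by (simp only: real_norm_def abs_mult)
  qed
  then show "\<exists>N. \<forall>n\<ge>N. norm (x n * y n) \<le> (x n)\<^sup>2 + (y n)\<^sup>2" by blast
qed

instantiation ell2 :: real_vector
begin

lift_definition zero_ell2 :: ell2 is "\<lambda>_. 0" by simp
lift_definition plus_ell2 :: "ell2 \<Rightarrow> ell2 \<Rightarrow> ell2" is "\<lambda>x y n. x n + y n"
  by (rule summable_sq_add)
lift_definition uminus_ell2 :: "ell2 \<Rightarrow> ell2" is "\<lambda>x n. - x n" by simp
lift_definition minus_ell2 :: "ell2 \<Rightarrow> ell2 \<Rightarrow> ell2" is "\<lambda>x y n. x n - y n"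
  using summable_sq_add[of _ "\<lambda>n. - _ n"] by simp
lift_definition scaleR_ell2 :: "real \<Rightarrow> ell2 \<Rightarrow> ell2" is "\<lambda>c x n. c * x n"
  by (rule summable_sq_scale)

instance
  by standard (transfer; auto simp: algebra_simps)+

end

instantiation ell2 :: real_inner
begin

lift_definition inner_ell2 :: "ell2 \<Rightarrow> ell2 \<Rightarrow> real" is "\<lambda>x y. \<Sum>n. x n * y n" .

definition norm_ell2 :: "ell2 \<Rightarrow> real" where "norm_ell2 x = sqrt (inner x x)"
definition sgn_ell2 :: "ell2 \<Rightarrow> ell2" where "sgn_ell2 x = x /\<^sub>R norm x"
definition dist_ell2 :: "ell2 \<Rightarrow> ell2 \<Rightarrow> real" where "dist_ell2 x y = norm (x - y)"
definition uniformity_ell2 :: "(ell2 \<times> ell2) filter" where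
  "uniformity_ell2 = (INF e\<in>{0<..}. principal {(x, y). dist x y < e})"
definition open_ell2 :: "ell2 set \<Rightarrow> bool" where
  "open_ell2 S = (\<forall>x\<in>S. \<forall>\<^sub>F (x', y) in uniformity. x' = x \<longrightarrow> y \<in> S)"

instance
proof
  fix x y z :: ell2 and r :: real and S :: "ell2 set"
  show "dist x y = norm (x - y)" "sgn x = x /\<^sub>R norm x" "norm x = sqrt (inner x x)"
    "uniformity = (INF e\<in>{0<..}. principal {(x::ell2, y). dist x y < e})"
    "open S = (\<forall>x\<in>S. \<forall>\<^sub>F (x', y) in uniformity. x' = x \<longrightarrow> y \<in> S)"
    by (simp_all only: dist_ell2_def sgn_ell2_def norm_ell2_def uniformity_ell2_def open_ell2_def)
  show "inner x y = inner y x" by transfer (simp add: mult.commute)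
  show "inner (x + y) z = inner x z + inner y z"
    by transfer (simp add: distrib_right suminf_add summable_prod)
  show "inner (r *\<^sub>R x) y = r * inner x y"
    by transfer (simp add: mult.assoc suminf_mult summable_prod)
  show "0 \<le> inner x x"
    by transfer (auto intro!: suminf_nonneg simp: summable_prod)
  show "(inner x x = 0) = (x = 0)"
    by transfer (auto simp: fun_eq_iff suminf_eq_zero_iff summable_prod)
qed

end

definition positive_sphere :: "ell2 set" where
  "positive_sphere = {x \<in> sphere 0 1. \<forall>n. 0 < seq_of x n}"


section \<open>The probability simplex\<close>

definition prob_simplex :: "(nat \<Rightarrow> real) set" where
  "prob_simplex = {p. summable (\<lambda>n. \<bar>p n\<bar>) \<and> (\<Sum>n. p n) = 1 \<and> (\<forall>n. 0 < p n)}"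

definition Phi :: "(nat \<Rightarrow> real) \<Rightarrow> ell2" where
  "Phi p = Abs_ell2 (\<lambda>n. sqrt (p n))"

lemma prob_simplex_summable: "p \<in> prob_simplex \<Longrightarrow> summable p"
  unfolding prob_simplex_def by (auto intro: summable_rabs_cancel)

lemma seq_of_Phi:
  assumes "p \<in> prob_simplex"
  shows "seq_of (Phi p) = (\<lambda>n. sqrt (p n))"
proof -
  have "(\<lambda>n. (sqrt (p n))\<^sup>2) = p"
    using assms by (auto simp: prob_simplex_def less_imp_le)
  then show ?thesis
    using prob_simplex_summable[OF assms] by (simp add: Phi_def Abs_ell2_inverse)
qed

lemma bij_betw_Phi: "bij_betw Phi prob_simplex positive_sphere"
proof (rule bij_betw_imageI)
  show "inj_on Phi prob_simplex"
  proof (rule inj_onI)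
    fix p q assume "p \<in> prob_simplex" "q \<in> prob_simplex" "Phi p = Phi q"
    then have "(\<lambda>n. sqrt (p n)) = (\<lambda>n. sqrt (q n))"
      by (metis seq_of_Phi)
    then show "p = q" by (simp add: fun_eq_iff)
  qed
  have nrm: "norm x = sqrt (\<Sum>n. seq_of x n * seq_of x n)" for x
    by (simp add: norm_ell2_def inner_ell2.rep_eq)
  show "Phi ` prob_simplex = positive_sphere"
  proof (intro equalityI subsetI)
    fix x assume "x \<in> Phi ` prob_simplex"
    then obtain p where p: "p \<in> prob_simplex" "x = Phi p" by blast
    then have pos: "0 < p n" for n by (simp add: prob_simplex_def)
    then have "(\<Sum>n. sqrt (p n) * sqrt (p n)) = (\<Sum>n. p n)"
      by (simp add: less_imp_le)
    with p pos show "x \<in> positive_sphere"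
      by (simp add: positive_sphere_def nrm seq_of_Phi) (simp add: prob_simplex_def)
  next
    fix x assume x: "x \<in> positive_sphere"
    define p where "p = (\<lambda>n. (seq_of x n)\<^sup>2)"
    have pos: "0 < seq_of x n" for n using x by (simp add: positive_sphere_def)
    have "summable p" using seq_of[of x] by (simp add: p_def)
    moreover have "(\<Sum>n. p n) = 1"
      using x by (simp add: positive_sphere_def nrm p_def power2_eq_square)
    ultimately have p: "p \<in> prob_simplex"
      using pos by (auto simp: prob_simplex_def p_def less_imp_neq[symmetric])
    have "seq_of (Phi p) = seq_of x"
      unfolding seq_of_Phi[OF p] using pos by (simp add: p_def less_imp_le)
    then have "Phi p = x" by (simp add: seq_of_inject)
    with p show "x \<in> Phi ` prob_simplex" by blast
  qed
qed

definition tangent_space :: "(nat \<Rightarrow> real) \<Rightarrow> (nat \<Rightarrow> real) set" where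
  "tangent_space p = {v. summable (\<lambda>n. \<bar>v n\<bar>) \<and> (\<Sum>n. v n) = 0 \<and>
     summable (\<lambda>n. (v n / sqrt (p n))\<^sup>2)}"


section \<open>Smooth curves and e-geodesics\<close>

text \<open>\<open>D k\<close> is the \<open>k\<close>-th derivative of \<open>c\<close>.\<close>

definition smooth_curve :: "(real \<Rightarrow> 'a :: real_normed_vector) \<Rightarrow> bool" where
  "smooth_curve c \<longleftrightarrow> (\<exists>D :: nat \<Rightarrow> real \<Rightarrow> 'a. D 0 = c \<and>
     (\<forall>k t. (D k has_vector_derivative D (Suc k) t) (at t)))"

text \<open>Since \<^const>\<open>Phi\<close> is by definition a diffeomorphism onto a subset of the unit sphere,
  a curve in the simplex is smooth iff its image is smooth as a curve in \<^typ>\<open>ell2\<close>.\<close>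

definition smooth_simplex_curve :: "(real \<Rightarrow> nat \<Rightarrow> real) \<Rightarrow> bool" where
  "smooth_simplex_curve p \<longleftrightarrow> (\<forall>t. p t \<in> prob_simplex) \<and> smooth_curve (\<lambda>t. Phi (p t))"

definition velocity :: "(real \<Rightarrow> nat \<Rightarrow> real) \<Rightarrow> real \<Rightarrow> nat \<Rightarrow> real" where
  "velocity p t n = deriv (\<lambda>s. p s n) t"

text \<open>The e-connection \<open>\<nabla>\<^sub>V W\<close> along a curve \<open>p\<close>, with \<open>V\<close> the velocity of \<open>p\<close> and \<open>W\<close> a vector
  field along \<open>p\<close>; the directional derivative along \<open>V\<close> is then \<open>d/dt\<close>. For a smooth curve and
  \<open>W = V\<close> the series converges absolutely: with \<open>x = Phi p\<close>, its terms are
  \<open>2 (x\<^sub>k x\<^sub>k'' - (x\<^sub>k')\<^sup>2)\<close>.\<close>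

definition e_connection ::
  "(real \<Rightarrow> nat \<Rightarrow> real) \<Rightarrow> (real \<Rightarrow> nat \<Rightarrow> real) \<Rightarrow> real \<Rightarrow> nat \<Rightarrow> real" where
  "e_connection p W t n = p t n * (deriv (\<lambda>s. W s n / p s n) t
     - (\<Sum>k. p t k * deriv (\<lambda>s. W s k / p s k) t))"

definition e_geodesic :: "(real \<Rightarrow> nat \<Rightarrow> real) \<Rightarrow> bool" where
  "e_geodesic p \<longleftrightarrow> smooth_simplex_curve p \<and> (\<forall>t n. e_connection p (velocity p) t n = 0)"

text \<open>Existence for all times of the e-geodesic with given initial data. This is not automatic for
  tangent vectors: for \<open>p\<^sub>n = 1 / 2 ^ (n + 1)\<close> and \<open>v\<^sub>n = (n - 1) p\<^sub>n\<close>, which is tangent at \<open>p\<close>,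
  the normalising series \<open>\<Sum>\<^sub>k p\<^sub>k exp (t v\<^sub>k / p\<^sub>k)\<close> diverges for \<open>t \<ge> ln 2\<close>, and there is no global
  e-geodesic. Unconditional geodesic completeness is therefore false, and has to be stated
  together with the convergence of that series.\<close>

definition global_e_geodesic_exists :: "(nat \<Rightarrow> real) \<Rightarrow> (nat \<Rightarrow> real) \<Rightarrow> bool" where
  "global_e_geodesic_exists p0 v0 \<longleftrightarrow> (\<exists>p. e_geodesic p \<and> p 0 = p0 \<and> velocity p 0 = v0)"

end

theory Submission
  imports Defs
begin

text \<open>Write \<open>u\<^sub>n = p\<^sub>n' / p\<^sub>n\<close>. The geodesic equation says that all \<open>u\<^sub>n'\<close> agree, i.e. that
  \<open>u\<^sub>n - u\<^sub>0\<close> is constant in time, i.e. that \<open>ln (p\<^sub>n / p\<^sub>0)\<close> is affine; summing over \<open>n\<close>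
  determines the normalisation. Conversely, if the normalising series converges at all times, then
  \<open>t \<mapsto> (sqrt (p\<^sub>n(0)) exp (b\<^sub>n t / 2))\<^sub>n\<close> is a smooth curve in \<open>\<ell>\<^sup>2\<close>, since polynomial factors
  in \<open>b\<^sub>n\<close> are absorbed by shifting \<open>t\<close> by \<open>\<plusminus>1\<close>, and its radial projection to the sphere is the
  image of the geodesic.\<close>

section \<open>Smooth curves\<close>

text \<open>Choosing a derivative inside \<open>S\<close> and iterating the choice yields
  derivatives of every order. Smoothness thus needs only a set of curves closed under
  differentiation, with no formula for the k-th derivative.\<close>

lemma smooth_curve_coinduct:
  assumes "c \<in> S"
    and step: "\<And>f. f \<in> S \<Longrightarrow> \<exists>g\<in>S. \<forall>t. (f has_vector_derivative g t) (at t)"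
  shows "smooth_curve c"
proof -
  obtain d where d: "\<And>f. f \<in> S \<Longrightarrow> d f \<in> S \<and> (\<forall>t. (f has_vector_derivative d f t) (at t))"
    using step by metis
  define D where "D = (\<lambda>k. (d ^^ k) c)"
  have "D k \<in> S" for k
    by (induction k) (use assms(1) d in \<open>auto simp: D_def\<close>)
  then have "D 0 = c \<and> (\<forall>k t. (D k has_vector_derivative D (Suc k) t) (at t))"
    using d by (auto simp: D_def)
  then show ?thesis
    unfolding smooth_curve_def by blast
qed

text \<open>If \<open>D\<close> lists the derivatives of a nowhere vanishing curve, this algebra and the module below
  are closed under differentiation, and the module contains the normalised curve.\<close>

inductive_set norm_algebra :: "(nat \<Rightarrow> real \<Rightarrow> 'a :: real_inner) \<Rightarrow> (real \<Rightarrow> real) set"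
  for D :: "nat \<Rightarrow> real \<Rightarrow> 'a" where
  const: "(\<lambda>t. c) \<in> norm_algebra D"
| inner: "(\<lambda>t. inner (D i t) (D j t)) \<in> norm_algebra D"
| inverse_norm: "(\<lambda>t. inverse (norm (D 0 t))) \<in> norm_algebra D"
| add: "f \<in> norm_algebra D \<Longrightarrow> g \<in> norm_algebra D \<Longrightarrow> (\<lambda>t. f t + g t) \<in> norm_algebra D"
| mult: "f \<in> norm_algebra D \<Longrightarrow> g \<in> norm_algebra D \<Longrightarrow> (\<lambda>t. f t * g t) \<in> norm_algebra D"

inductive_set norm_module :: "(nat \<Rightarrow> real \<Rightarrow> 'a :: real_inner) \<Rightarrow> (real \<Rightarrow> 'a) set"
  for D :: "nat \<Rightarrow> real \<Rightarrow> 'a" where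
  scale: "f \<in> norm_algebra D \<Longrightarrow> (\<lambda>t. f t *\<^sub>R D i t) \<in> norm_module D"
| add: "v \<in> norm_module D \<Longrightarrow> w \<in> norm_module D \<Longrightarrow> (\<lambda>t. v t + w t) \<in> norm_module D"

text \<open>The product rule sends inner products of derivatives to sums of such products. Only the
  reciprocal norm N needs care: N' = -N^3 <D_0, D_1> is again a polynomial in the generators, which
  explains their choice.\<close>

lemma norm_algebra_deriv:
  fixes D :: "nat \<Rightarrow> real \<Rightarrow> 'a :: real_inner"
  assumes D: "\<And>k t. (D k has_vector_derivative D (Suc k) t) (at t)"
    and nz: "\<And>t. D 0 t \<noteq> 0"
    and "f \<in> norm_algebra D"
  shows "\<exists>g\<in>norm_algebra D. \<forall>t. (f has_real_derivative g t) (at t)"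
  using assms(3)
proof induction
  case (const c)
  then show ?case
    by (intro bexI[of _ "\<lambda>t. 0"]) (auto intro: norm_algebra.const)
next
  case (inner i j)
  have "((\<lambda>t. inner (D i t) (D j t)) has_real_derivative
      inner (D i t) (D (Suc j) t) + inner (D (Suc i) t) (D j t)) (at t)" for t
    using bounded_bilinear.has_vector_derivative[OF bounded_bilinear_inner D D]
    by (simp add: has_real_derivative_iff_has_vector_derivative)
  then show ?case
    by (intro bexI[of _ "\<lambda>t. inner (D i t) (D (Suc j) t) + inner (D (Suc i) t) (D j t)"])
      (auto intro: norm_algebra.intros)
next
  case inverse_norm
  define N where "N = (\<lambda>t. inverse (norm (D 0 t)))"
  \<comment> \<open>The constant factor -1 and the nested binary products match the introduction
    rules of \<open>norm_algebra\<close> literally.\<close>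
  define g where "g = (\<lambda>t. - 1 * (N t * (N t * N t) * inner (D 0 t) (D 1 t)))"
  have "(N has_real_derivative g t) (at t)" for t
  proof -
    have pos: "0 < inner (D 0 t) (D 0 t)"
      using nz by simp
    have "((\<lambda>t. inner (D 0 t) (D 0 t)) has_real_derivative 2 * inner (D 0 t) (D 1 t)) (at t)"
      using bounded_bilinear.has_vector_derivative[OF bounded_bilinear_inner D[of 0 t] D[of 0 t]]
      by (simp add: has_real_derivative_iff_has_vector_derivative inner_commute)
    from DERIV_inverse'[OF DERIV_chain2[OF DERIV_real_sqrt[OF pos] this]] pos
    show ?thesis
      by (simp add: g_def N_def norm_eq_sqrt_inner mult_ac)
  qed
  moreover have "g \<in> norm_algebra D"
    unfolding g_def N_def by (intro norm_algebra.intros)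
  ultimately show ?case
    unfolding N_def by blast
next
  case (add f g)
  then obtain f' g' where "f' \<in> norm_algebra D" "\<And>t. (f has_real_derivative f' t) (at t)"
    "g' \<in> norm_algebra D" "\<And>t. (g has_real_derivative g' t) (at t)"
    by blast
  then show ?case
    by (intro bexI[of _ "\<lambda>t. f' t + g' t"]) (auto intro: norm_algebra.intros DERIV_add)
next
  case (mult f g)
  then obtain f' g' where "f' \<in> norm_algebra D" "\<And>t. (f has_real_derivative f' t) (at t)"
    "g' \<in> norm_algebra D" "\<And>t. (g has_real_derivative g' t) (at t)"
    by blast
  with mult.hyps show ?case
    by (intro bexI[of _ "\<lambda>t. f' t * g t + g' t * f t"])
      (auto intro: norm_algebra.intros DERIV_mult)
qed

lemma norm_module_deriv:
  fixes D :: "nat \<Rightarrow> real \<Rightarrow> 'a :: real_inner"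
  assumes D: "\<And>k t. (D k has_vector_derivative D (Suc k) t) (at t)"
    and nz: "\<And>t. D 0 t \<noteq> 0"
    and "v \<in> norm_module D"
  shows "\<exists>w\<in>norm_module D. \<forall>t. (v has_vector_derivative w t) (at t)"
  using assms(3)
proof induction
  case (scale f i)
  then obtain g where g: "g \<in> norm_algebra D" "\<And>t. (f has_real_derivative g t) (at t)"
    using norm_algebra_deriv[OF D nz] by blast
  have "((\<lambda>t. f t *\<^sub>R D i t) has_vector_derivative
      f t *\<^sub>R D (Suc i) t + g t *\<^sub>R D i t) (at t)" for t
    using has_vector_derivative_scaleR[OF g(2) D] .
  with scale g show ?case
    by (intro bexI[of _ "\<lambda>t. f t *\<^sub>R D (Suc i) t + g t *\<^sub>R D i t"])
      (auto intro: norm_module.intros)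
next
  case (add v w)
  then obtain v' w' where "v' \<in> norm_module D" "\<And>t. (v has_vector_derivative v' t) (at t)"
    "w' \<in> norm_module D" "\<And>t. (w has_vector_derivative w' t) (at t)"
    by blast
  then show ?case
    by (intro bexI[of _ "\<lambda>t. v' t + w' t"])
      (auto intro: norm_module.intros has_vector_derivative_add)
qed

text \<open>This is the radial projection to the unit sphere. Since \<open>sgn\<close> multiplies
  \<open>D 0\<close> by its reciprocal norm, the projected curve is an element of
  \<open>norm_module D\<close>.\<close>

lemma smooth_curve_sgn:
  fixes c :: "real \<Rightarrow> 'a :: real_inner"
  assumes "smooth_curve c" and nz: "\<And>t. c t \<noteq> 0"
  shows "smooth_curve (\<lambda>t. sgn (c t))"
proof -
  obtain D where D0: "D 0 = c" and D: "\<And>k t. (D k has_vector_derivative D (Suc k) t) (at t)"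
    using assms(1) unfolding smooth_curve_def by blast
  show ?thesis
  proof (rule smooth_curve_coinduct[where S = "norm_module D"])
    have "(\<lambda>t. inverse (norm (D 0 t)) *\<^sub>R D 0 t) \<in> norm_module D"
      by (intro norm_module.scale norm_algebra.inverse_norm)
    then show "(\<lambda>t. sgn (c t)) \<in> norm_module D"
      by (simp add: D0 sgn_div_norm)
    show "\<exists>w\<in>norm_module D. \<forall>t. (v has_vector_derivative w t) (at t)"
      if "v \<in> norm_module D" for v
      using norm_module_deriv[OF D _ that] nz D0 by metis
  qed
qed

section \<open>Coordinates of \<open>\<ell>\<^sup>2\<close>\<close>

lemma seq_of_Abs_ell2: "summable (\<lambda>n. (x n)\<^sup>2) \<Longrightarrow> seq_of (Abs_ell2 x) = x"
  by (simp add: Abs_ell2_inverse)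

lemma summable_seq_of_sq: "summable (\<lambda>n. (seq_of x n)\<^sup>2)"
  using seq_of[of x] by simp

lemma norm_ell2_sq: "(norm x)\<^sup>2 = (\<Sum>n. (seq_of x n)\<^sup>2)"
  using power2_norm_eq_inner[of x] by (simp add: inner_ell2.rep_eq power2_eq_square)

lemma norm_ell2_mono:
  assumes "\<And>n. \<bar>seq_of x n\<bar> \<le> \<bar>seq_of y n\<bar>"
  shows "norm x \<le> norm y"
proof -
  have "(norm x)\<^sup>2 \<le> (norm y)\<^sup>2"
    unfolding norm_ell2_sq
    by (intro suminf_le summable_seq_of_sq) (use assms in \<open>simp add: abs_le_square_iff\<close>)
  then show ?thesis
    by (simp add: power2_le_iff_abs_le)
qed

lemma abs_seq_of_le_norm: "\<bar>seq_of x n\<bar> \<le> norm x"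
proof -
  have "(\<Sum>i\<in>{n}. (seq_of x i)\<^sup>2) \<le> (\<Sum>i. (seq_of x i)\<^sup>2)"
    by (intro sum_le_suminf summable_seq_of_sq) auto
  then have "(seq_of x n)\<^sup>2 \<le> (norm x)\<^sup>2"
    by (simp add: norm_ell2_sq)
  then show ?thesis
    using abs_le_square_iff[of "seq_of x n" "norm x"] by simp
qed

lemma bounded_linear_seq_of: "bounded_linear (\<lambda>x. seq_of x n)"
  by (rule bounded_linear_intro[where K = 1])
    (simp_all add: plus_ell2.rep_eq scaleR_ell2.rep_eq abs_seq_of_le_norm)

lemma seq_of_has_real_derivative:
  assumes "(c has_vector_derivative c') (at t)"
  shows "((\<lambda>s. seq_of (c s) n) has_real_derivative seq_of c' n) (at t)"
  using bounded_linear.has_vector_derivative[OF bounded_linear_seq_of assms, of n]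
  by (simp add: has_real_derivative_iff_has_vector_derivative)

text \<open>Dividing the bound by |h| leaves K |h|, which tends to 0. Restricting to |h| \<le> 1
  lets K absorb exponential factors such as exp |c h|.\<close>

lemma has_vector_derivative_quadratic_remainder:
  fixes c :: "real \<Rightarrow> 'a :: real_normed_vector"
  assumes bound: "\<And>h. \<bar>h\<bar> \<le> 1 \<Longrightarrow> norm (c (t + h) - c t - h *\<^sub>R d) \<le> K * h\<^sup>2"
  shows "(c has_vector_derivative d) (at t)"
  unfolding has_vector_derivative_def has_derivative_at
proof (intro conjI)
  show "bounded_linear (\<lambda>x. x *\<^sub>R d)"
    by (rule bounded_linear_scaleR_left)
  show "(\<lambda>h. norm (c (t + h) - c t - h *\<^sub>R d) / norm h) \<midarrow>0\<rightarrow> 0"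
  proof (rule Lim_null_comparison)
    have "((\<lambda>h::real. K * \<bar>h\<bar>) \<longlongrightarrow> K * \<bar>0\<bar>) (at 0)"
      by (intro tendsto_intros)
    then show "((\<lambda>h::real. K * \<bar>h\<bar>) \<longlongrightarrow> 0) (at 0)"
      by simp
    have "eventually (\<lambda>h::real. \<bar>h\<bar> \<le> 1 \<and> h \<noteq> 0) (at 0)"
      unfolding eventually_at by (rule exI[of _ 1]) (auto simp: dist_real_def)
    then show "\<forall>\<^sub>F h in at 0. norm (norm (c (t + h) - c t - h *\<^sub>R d) / norm h) \<le> K * \<bar>h\<bar>"
    proof eventually_elim
      case (elim h)
      then have "norm (c (t + h) - c t - h *\<^sub>R d) \<le> K * \<bar>h\<bar> * \<bar>h\<bar>"
        using bound[of h] by (simp add: power2_eq_square mult.assoc)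
      then show ?case
        using elim by (simp add: divide_le_eq)
    qed
  qed
qed

section \<open>Exponential curves in \<open>\<ell>\<^sup>2\<close>\<close>

lemma power_le_fact_mult_exp:
  fixes x :: real
  assumes "0 \<le> x"
  shows "x ^ k \<le> fact k * exp x"
proof -
  have sums: "(\<lambda>n. x ^ n /\<^sub>R fact n) sums exp x"
    by (rule exp_converges)
  have "(\<Sum>n\<in>{k}. x ^ n /\<^sub>R fact n) \<le> exp x"
    unfolding sums_unique[OF sums]
    by (intro sum_le_suminf sums_summable[OF sums]) (use assms in auto)
  then show ?thesis
    by (simp add: field_simps)
qed

lemma exp_abs_le: "exp \<bar>x\<bar> \<le> exp x + exp (- x :: real)"
  by (cases "0 \<le> x") simp_all

text \<open>After factoring out exp (c t), this is the Lagrange remainder of order two. Its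
  intermediate point satisfies |s| \<le> |c h| \<le> |c|, so exp |c| bounds it uniformly in
  h.\<close>

lemma exp_quadratic_remainder:
  fixes c h t :: real
  assumes "\<bar>h\<bar> \<le> 1"
  shows "\<bar>exp (c * (t + h)) - exp (c * t) - h * (c * exp (c * t))\<bar>
    \<le> c\<^sup>2 * exp \<bar>c\<bar> * exp (c * t) * h\<^sup>2"
proof -
  obtain s where s: "\<bar>s\<bar> \<le> \<bar>c * h\<bar>"
    "exp (c * h) = (\<Sum>m<2. (c * h) ^ m / fact m) + exp s / fact 2 * (c * h) ^ 2"
    using Maclaurin_exp_le[of "c * h" 2] by blast
  have "\<bar>c * h\<bar> \<le> \<bar>c\<bar>"
    using assms by (simp add: abs_mult mult_left_le)
  then have "exp s \<le> exp \<bar>c\<bar>"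
    using s(1) by simp
  then have "exp s / 2 * (c * h)\<^sup>2 \<le> exp \<bar>c\<bar> * (c * h)\<^sup>2"
    using exp_gt_zero[of s] by (intro mult_right_mono) (linarith | simp)+
  moreover have "exp (c * h) - 1 - c * h = exp s / 2 * (c * h)\<^sup>2"
    using s(2) by (simp add: numeral_2_eq_2)
  moreover have "0 \<le> exp s / 2 * (c * h)\<^sup>2"
    by simp
  ultimately have "\<bar>exp (c * h) - 1 - c * h\<bar> \<le> exp \<bar>c\<bar> * (c * h)\<^sup>2"
    by (simp only: abs_of_nonneg)
  then have "exp (c * t) * \<bar>exp (c * h) - 1 - c * h\<bar> \<le> exp (c * t) * (exp \<bar>c\<bar> * (c * h)\<^sup>2)"
    by (intro mult_left_mono) simp_all
  moreover have "exp (c * (t + h)) - exp (c * t) - h * (c * exp (c * t))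
      = exp (c * t) * (exp (c * h) - 1 - c * h)"
    by (simp add: exp_add algebra_simps)
  ultimately show ?thesis
    by (simp add: abs_mult power_mult_distrib mult_ac)
qed

text \<open>Squaring turns |c|^k \<le> k! exp |c| and the extra factor exp |c| into at most (k!)^2
  exp (4 |c|). As exp (4 |c|) \<le> exp (4 c) + exp (-4 c), this costs a shift of t by 2 in either
  direction: one unit for the power, one for the extra factor that the Taylor remainder
  requires.\<close>

lemma summable_power_exp_sq:
  fixes w c :: "nat \<Rightarrow> real"
  assumes "\<And>t. summable (\<lambda>n. (w n)\<^sup>2 * exp (2 * c n * t))"
  shows "summable (\<lambda>n. (w n * c n ^ k * exp (\<bar>c n\<bar> + c n * t))\<^sup>2)"
proof (rule summable_comparison_test)
  let ?C = "(fact k :: real)\<^sup>2"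
  let ?f = "\<lambda>n. ?C * ((w n)\<^sup>2 * exp (2 * c n * (t + 2)) + (w n)\<^sup>2 * exp (2 * c n * (t - 2)))"
  show "summable ?f"
    by (intro summable_mult summable_add assms)
  have "(w n * c n ^ k * exp (\<bar>c n\<bar> + c n * t))\<^sup>2 \<le> ?f n" for n
  proof -
    have "\<bar>c n\<bar> ^ k * exp \<bar>c n\<bar> \<le> fact k * exp \<bar>c n\<bar> * exp \<bar>c n\<bar>"
      by (intro mult_right_mono power_le_fact_mult_exp) simp_all
    then have "(\<bar>c n\<bar> ^ k * exp \<bar>c n\<bar>)\<^sup>2 \<le> (fact k * exp \<bar>c n\<bar> * exp \<bar>c n\<bar>)\<^sup>2"
      by (intro power_mono) simp_all
    also have "\<dots> = ?C * exp \<bar>4 * c n\<bar>"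
      by (simp add: power_mult_distrib power2_eq_square mult_exp_exp mult.assoc)
    also have "\<dots> \<le> ?C * (exp (4 * c n) + exp (- (4 * c n)))"
      by (intro mult_left_mono exp_abs_le) simp
    finally have "(w n)\<^sup>2 * (\<bar>c n\<bar> ^ k * exp \<bar>c n\<bar>)\<^sup>2 * exp (2 * c n * t)
        \<le> (w n)\<^sup>2 * (?C * (exp (4 * c n) + exp (- (4 * c n)))) * exp (2 * c n * t)"
      by (intro mult_right_mono mult_left_mono) simp_all
    also have "\<dots> = ?f n"
      by (simp add: algebra_simps exp_add exp_diff exp_minus inverse_eq_divide)
    also have "(w n)\<^sup>2 * (\<bar>c n\<bar> ^ k * exp \<bar>c n\<bar>)\<^sup>2 * exp (2 * c n * t)
        = (w n * c n ^ k * exp (\<bar>c n\<bar> + c n * t))\<^sup>2"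
    proof -
      have "exp (2 * c n * t) = (exp (c n * t))\<^sup>2"
        by (simp add: exp_double[symmetric] mult.assoc)
      then show ?thesis
        by (simp add: power_mult_distrib exp_add mult_ac flip: power_abs)
    qed
    finally show ?thesis .
  qed
  then show "\<exists>N. \<forall>n\<ge>N. norm ((w n * c n ^ k * exp (\<bar>c n\<bar> + c n * t))\<^sup>2) \<le> ?f n"
    by auto
qed

text \<open>\<open>Abs_ell2\<close> is meaningful only on square-summable sequences, so the
  coordinates can be read off only where \<open>summable_exp_sq\<close> applies.\<close>

definition exp_curve :: "(nat \<Rightarrow> real) \<Rightarrow> (nat \<Rightarrow> real) \<Rightarrow> real \<Rightarrow> ell2" where
  "exp_curve w c t = Abs_ell2 (\<lambda>n. w n * exp (c n * t))"

lemma summable_exp_sq: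
  fixes w c :: "nat \<Rightarrow> real"
  assumes "\<And>t. summable (\<lambda>n. (w n)\<^sup>2 * exp (2 * c n * t))"
  shows "summable (\<lambda>n. (w n * c n ^ k * exp (c n * t))\<^sup>2)"
proof (rule summable_comparison_test)
  show "summable (\<lambda>n. (w n * c n ^ k * exp (\<bar>c n\<bar> + c n * t))\<^sup>2)"
    by (rule summable_power_exp_sq[OF assms])
  have "\<bar>w n * c n ^ k * exp (c n * t)\<bar> \<le> \<bar>w n * c n ^ k * exp (\<bar>c n\<bar> + c n * t)\<bar>" for n
    unfolding abs_mult by (intro mult_left_mono) auto
  then show "\<exists>N. \<forall>n\<ge>N. norm ((w n * c n ^ k * exp (c n * t))\<^sup>2)
      \<le> (w n * c n ^ k * exp (\<bar>c n\<bar> + c n * t))\<^sup>2"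
    by (auto simp: abs_le_square_iff)
qed

lemma exp_curve_has_vector_derivative:
  fixes w c :: "nat \<Rightarrow> real"
  assumes summ: "\<And>t. summable (\<lambda>n. (w n)\<^sup>2 * exp (2 * c n * t))"
  shows "(exp_curve (\<lambda>n. w n * c n ^ k) c has_vector_derivative
    exp_curve (\<lambda>n. w n * c n ^ Suc k) c t) (at t)"
proof -
  \<comment> \<open>Q majorises the Taylor remainder coordinatewise: two more powers of c and the
    factor exp |c| come from \<open>exp_quadratic_remainder\<close>. Hence its norm serves as the
    constant K, uniformly in h.\<close>
  define Q where "Q = Abs_ell2 (\<lambda>n. w n * c n ^ (k + 2) * exp (\<bar>c n\<bar> + c n * t))"
  let ?e = "\<lambda>k. exp_curve (\<lambda>n. w n * c n ^ k) c"
  have seq: "seq_of (?e k t) n = w n * c n ^ k * exp (c n * t)" for k t n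
    using summable_exp_sq[OF summ, of k t] by (simp add: exp_curve_def seq_of_Abs_ell2)
  have seqQ: "seq_of Q n = w n * c n ^ (k + 2) * exp (\<bar>c n\<bar> + c n * t)" for n
    using summable_power_exp_sq[OF summ, of "k + 2" t] by (simp only: Q_def seq_of_Abs_ell2)
  show ?thesis
  proof (rule has_vector_derivative_quadratic_remainder[where K = "norm Q"])
    fix h :: real assume h: "\<bar>h\<bar> \<le> 1"
    have "norm (?e k (t + h) - ?e k t - h *\<^sub>R ?e (Suc k) t) \<le> norm (h\<^sup>2 *\<^sub>R Q)"
    proof (rule norm_ell2_mono)
      fix n
      have "seq_of (?e k (t + h) - ?e k t - h *\<^sub>R ?e (Suc k) t) n = w n * c n ^ k *
          (exp (c n * (t + h)) - exp (c n * t) - h * (c n * exp (c n * t)))"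
        by (simp only: minus_ell2.rep_eq scaleR_ell2.rep_eq seq) (simp add: algebra_simps)
      moreover have "\<bar>seq_of (h\<^sup>2 *\<^sub>R Q) n\<bar> =
          \<bar>w n * c n ^ k\<bar> * ((c n)\<^sup>2 * exp \<bar>c n\<bar> * exp (c n * t) * h\<^sup>2)"
        by (simp add: scaleR_ell2.rep_eq seqQ abs_mult exp_add power2_eq_square)
      ultimately show "\<bar>seq_of (?e k (t + h) - ?e k t - h *\<^sub>R ?e (Suc k) t) n\<bar>
          \<le> \<bar>seq_of (h\<^sup>2 *\<^sub>R Q) n\<bar>"
        using exp_quadratic_remainder[OF h, of "c n" t]
        by (simp only: abs_mult[of "w n * c n ^ k"] mult_left_mono abs_ge_zero)
    qed
    then show "norm (?e k (t + h) - ?e k t - h *\<^sub>R ?e (Suc k) t) \<le> norm Q * h\<^sup>2"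
      by (simp add: mult.commute)
  qed
qed

lemma smooth_curve_exp_curve:
  fixes w c :: "nat \<Rightarrow> real"
  assumes "\<And>t. summable (\<lambda>n. (w n)\<^sup>2 * exp (2 * c n * t))"
  shows "smooth_curve (exp_curve w c)"
  unfolding smooth_curve_def
  by (intro exI[of _ "\<lambda>k. exp_curve (\<lambda>n. w n * c n ^ k) c"] conjI allI)
    (simp, rule exp_curve_has_vector_derivative[OF assms])

section \<open>Smooth curves in the simplex\<close>

text \<open>This is the time derivative of ln p_n. With the index before the time,
  \<open>log_velocity p n\<close> is itself a function of time that can be differentiated.\<close>

definition log_velocity :: "(real \<Rightarrow> nat \<Rightarrow> real) \<Rightarrow> nat \<Rightarrow> real \<Rightarrow> real" where
  "log_velocity p n t = velocity p t n / p t n"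

context
  fixes p :: "real \<Rightarrow> nat \<Rightarrow> real"
  assumes smooth: "smooth_simplex_curve p"
begin

lemma simplex_curve_mem: "p t \<in> prob_simplex"
  using smooth by (simp add: smooth_simplex_curve_def)

lemma simplex_curve_pos: "0 < p t n"
  using simplex_curve_mem by (simp add: prob_simplex_def)

lemma simplex_curve_nonzero: "p t n \<noteq> 0"
  using simplex_curve_pos[of t n] by simp

lemma simplex_curve_sums: "p t sums 1"
  using simplex_curve_mem[of t] prob_simplex_summable[of "p t"]
  by (simp add: prob_simplex_def sums_iff)

text \<open>Smoothness is given for the image under \<open>Phi\<close> in \<open>ell2\<close>.
  Evaluating a coordinate is bounded linear, so x = sqrt p_n inherits the two derivatives that the
  geodesic equation involves.\<close>

lemma simplex_curve_coordinates:
  obtains x x1 x2 where "\<And>t. p t n = (x t)\<^sup>2" "\<And>t. 0 < x t"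
    "\<And>t. (x has_real_derivative x1 t) (at t)" "\<And>t. (x1 has_real_derivative x2 t) (at t)"
proof -
  obtain D where D0: "D 0 = (\<lambda>t. Phi (p t))"
    and D: "\<And>k t. (D k has_vector_derivative D (Suc k) t) (at t)"
    using smooth unfolding smooth_simplex_curve_def smooth_curve_def by blast
  have x: "seq_of (D 0 t) n = sqrt (p t n)" for t
    by (simp add: D0 seq_of_Phi[OF simplex_curve_mem])
  show thesis
  proof (rule that)
    show "p t n = (seq_of (D 0 t) n)\<^sup>2" "0 < seq_of (D 0 t) n" for t
      using simplex_curve_pos[of t n] by (simp_all add: x)
  qed (rule seq_of_has_real_derivative[OF D])+
qed

lemma simplex_curve_derivatives:
  shows simplex_curve_velocity: "((\<lambda>s. p s n) has_real_derivative velocity p t n) (at t)"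
    and log_velocity_deriv:
      "(log_velocity p n has_real_derivative deriv (log_velocity p n) t) (at t)"
proof -
  obtain x x1 x2 where x: "\<And>t. p t n = (x t)\<^sup>2" "\<And>t. 0 < x t"
    "\<And>t. (x has_real_derivative x1 t) (at t)" "\<And>t. (x1 has_real_derivative x2 t) (at t)"
    by (rule simplex_curve_coordinates[of n]) (rule that)
  have d: "((\<lambda>s. p s n) has_real_derivative 2 * x t * x1 t) (at t)" for t
    unfolding x(1) by (auto intro!: derivative_eq_intros x(3))
  have v: "velocity p t n = 2 * x t * x1 t" for t
    using DERIV_imp_deriv[OF d] by (simp add: velocity_def)
  show "((\<lambda>s. p s n) has_real_derivative velocity p t n) (at t)"
    using d v by simp
  \<comment> \<open>With p_n = x^2 the velocity is 2 x x', so one factor x cancels; the quotient is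
    differentiable because x stays positive.\<close>
  have "log_velocity p n = (\<lambda>t. 2 * x1 t / x t)"
    using x(2) by (auto simp: log_velocity_def x(1) v fun_eq_iff power2_eq_square
        less_imp_neq[symmetric])
  moreover have "((\<lambda>t. 2 * x1 t / x t) has_real_derivative
      (2 * x2 t * x t - 2 * x1 t * x1 t) / (x t * x t)) (at t)"
    using x(2)[of t] by (intro DERIV_divide DERIV_cmult x(3,4)) simp
  ultimately obtain e where e: "(log_velocity p n has_real_derivative e) (at t)"
    by metis
  show "(log_velocity p n has_real_derivative deriv (log_velocity p n) t) (at t)"
    using e DERIV_imp_deriv[OF e] by simp
qed

section \<open>The geodesic equation through logarithmic velocities\<close>

lemma e_connection_velocity:
  "e_connection p (velocity p) t n = p t n * (deriv (log_velocity p n) t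
     - (\<Sum>k. p t k * deriv (log_velocity p k) t))"
  by (simp add: e_connection_def log_velocity_def[abs_def])

lemma e_geodesic_iff_log_velocity:
  "e_geodesic p \<longleftrightarrow>
    (\<forall>n t. log_velocity p n t - log_velocity p 0 t = log_velocity p n 0 - log_velocity p 0 0)"
proof
  assume "e_geodesic p"
  then have prod_zero: "p t n * (deriv (log_velocity p n) t
      - (\<Sum>k. p t k * deriv (log_velocity p k) t)) = 0" for t n
    unfolding e_geodesic_def e_connection_velocity by blast
  have mean: "deriv (log_velocity p n) t = (\<Sum>k. p t k * deriv (log_velocity p k) t)" for n t
    using prod_zero[of t n] simplex_curve_nonzero[of t n] by simp
  \<comment> \<open>The right side of \<open>mean\<close> is independent of n, so comparing n with 0
    eliminates the series.\<close>
  have eq: "deriv (log_velocity p n) t = deriv (log_velocity p 0) t" for n t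
    by (rule trans[OF mean mean[symmetric]])
  have "((\<lambda>t. log_velocity p n t - log_velocity p 0 t) has_real_derivative 0) (at t)" for n t
    using DERIV_diff[OF log_velocity_deriv[of n t] log_velocity_deriv[of 0 t]]
    by (simp add: eq[of n])
  then show "\<forall>n t. log_velocity p n t - log_velocity p 0 t
      = log_velocity p n 0 - log_velocity p 0 0"
    using DERIV_isconst_all[where f = "\<lambda>t. log_velocity p n t - log_velocity p 0 t" for n] by blast
next
  assume const: "\<forall>n t. log_velocity p n t - log_velocity p 0 t
      = log_velocity p n 0 - log_velocity p 0 0"
  have eq: "deriv (log_velocity p n) t = deriv (log_velocity p 0) t" for n t
  proof -
    have "log_velocity p n s = log_velocity p 0 s + (log_velocity p n 0 - log_velocity p 0 0)" for s
      using const[rule_format, of n s] by linarith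
    then have "log_velocity p n
        = (\<lambda>t. log_velocity p 0 t + (log_velocity p n 0 - log_velocity p 0 0))"
      by (rule ext)
    then have "(log_velocity p n has_real_derivative deriv (log_velocity p 0) t) (at t)"
      using DERIV_add[OF log_velocity_deriv[of 0 t]
          DERIV_const[of "log_velocity p n 0 - log_velocity p 0 0"]]
      by (simp only: add_0_right)
    then show ?thesis
      by (rule DERIV_imp_deriv)
  qed
  \<comment> \<open>A derivative common to all coordinates equals its own mean because the weights
    p_k sum to 1.\<close>
  have "(\<Sum>k. p t k * deriv (log_velocity p k) t) = deriv (log_velocity p 0) t" for t
  proof -
    have "(\<lambda>k. p t k * deriv (log_velocity p k) t) = (\<lambda>k. p t k * deriv (log_velocity p 0) t)"
      by (intro ext arg_cong2[of _ _ _ _ "(*)"] refl eq)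
    then show ?thesis
      using sums_mult2[OF simplex_curve_sums[of t], of "deriv (log_velocity p 0) t"]
      by (simp add: sums_iff)
  qed
  then have "e_connection p (velocity p) t n = 0" for t n
    by (simp add: e_connection_velocity eq[of n])
  with smooth show "e_geodesic p"
    by (simp add: e_geodesic_def)
qed

section \<open>The exponential form of e-geodesics\<close>

lemma ln_ratio_deriv:
  "((\<lambda>s. ln (p s n) - ln (p s 0)) has_real_derivative log_velocity p n t - log_velocity p 0 t)
    (at t)"
proof -
  have "((\<lambda>s. ln (p s k)) has_real_derivative log_velocity p k t) (at t)" for k
    using DERIV_ln_divide[THEN DERIV_chain2, OF simplex_curve_pos simplex_curve_velocity]
    by (simp add: log_velocity_def)
  then show ?thesis
    by (intro DERIV_diff)
qed

lemma e_geodesic_iff_exponential: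
  "e_geodesic p \<longleftrightarrow>
    (\<exists>(l::real) a. (\<forall>n. a n = velocity p 0 n / p 0 n + l) \<and>
      (\<forall>t. summable (\<lambda>k. p 0 k * exp (a k * t))) \<and>
      (\<forall>n t. p t n = p 0 n * exp (a n * t) / (\<Sum>k. p 0 k * exp (a k * t))))"
proof
  assume geod: "e_geodesic p"
  \<comment> \<open>This corresponds to \<lambda> = -u_0(0), so that a_0 = 0. Changing \<lambda>
    multiplies numerator and denominator of the solution by the same exponential in t.\<close>
  define a where "a = (\<lambda>n. log_velocity p n 0 - log_velocity p 0 0)"
  have ratio: "p 0 n * exp (a n * t) = p 0 0 / p t 0 * p t n" for n t
  proof -
    have "log_velocity p n s - log_velocity p 0 s - a n = 0" for s
      using geod unfolding e_geodesic_iff_log_velocity a_def right_minus_eq by blast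
    then have "((\<lambda>s. ln (p s n) - ln (p s 0) - a n * s) has_real_derivative 0) (at s)" for s
      using DERIV_diff[OF ln_ratio_deriv[of n s] DERIV_cmult_Id[of "a n"]] by simp
    then have "ln (p t n) - ln (p t 0) - a n * t = ln (p 0 n) - ln (p 0 0) - a n * 0"
      using DERIV_isconst_all[where f = "\<lambda>t. ln (p t n) - ln (p t 0) - a n * t"] by blast
    then have "ln (p 0 n) + a n * t = ln (p 0 0) - ln (p t 0) + ln (p t n)"
      by simp
    then have "exp (ln (p 0 n) + a n * t) = exp (ln (p 0 0) - ln (p t 0) + ln (p t n))"
      by simp
    then show ?thesis
      by (simp add: exp_add exp_diff simplex_curve_pos)
  qed
  \<comment> \<open>By \<open>ratio\<close> the unnormalised sequence is p(t) times a factor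
    independent of n. As p(t) sums to 1, this gives convergence and identifies that factor as the
    normaliser.\<close>
  have sums: "(\<lambda>k. p 0 k * exp (a k * t)) sums (p 0 0 / p t 0)" for t
    unfolding ratio using sums_mult[OF simplex_curve_sums[of t], of "p 0 0 / p t 0"] by simp
  have form: "p t n = p 0 n * exp (a n * t) / (\<Sum>k. p 0 k * exp (a k * t))" for n t
    unfolding sums_unique[OF sums, symmetric] unfolding ratio
    using simplex_curve_pos[of 0 0] simplex_curve_pos[of t 0] by simp
  have a_eq: "a n = velocity p 0 n / p 0 n + - log_velocity p 0 0" for n
    by (simp add: a_def log_velocity_def)
  show "\<exists>(l::real) a. (\<forall>n. a n = velocity p 0 n / p 0 n + l) \<and>
      (\<forall>t. summable (\<lambda>k. p 0 k * exp (a k * t))) \<and>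
      (\<forall>n t. p t n = p 0 n * exp (a n * t) / (\<Sum>k. p 0 k * exp (a k * t)))"
    by (intro exI[of _ "- log_velocity p 0 0"] exI[of _ a] conjI allI)
      (rule a_eq form sums_summable[OF sums])+
next
  assume "\<exists>(l::real) a. (\<forall>n. a n = velocity p 0 n / p 0 n + l) \<and>
      (\<forall>t. summable (\<lambda>k. p 0 k * exp (a k * t))) \<and>
      (\<forall>n t. p t n = p 0 n * exp (a n * t) / (\<Sum>k. p 0 k * exp (a k * t)))"
  then obtain a
    where form: "\<And>n t. p t n = p 0 n * exp (a n * t) / (\<Sum>k. p 0 k * exp (a k * t))"
    by blast
  \<comment> \<open>The formula itself forces this sign: both p_0(t) and its numerator are positive,
    hence so is the denominator.\<close>
  have pos: "0 < (\<Sum>k. p 0 k * exp (a k * t))" for t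
    using simplex_curve_pos[of t 0] simplex_curve_pos[of 0 0]
    unfolding form[of t 0] by (simp add: zero_less_divide_iff zero_less_mult_iff mult_less_0_iff)
  have ln_p: "ln (p t n) = ln (p 0 n) + a n * t - ln (\<Sum>k. p 0 k * exp (a k * t))" for n t
    using simplex_curve_pos[of 0 n] pos[of t]
    by (subst form[of t n]) (simp add: ln_div ln_mult)
  \<comment> \<open>The normaliser cancels in the logarithmic ratio, leaving an affine function of
    slope a_n - a_0.\<close>
  have "(\<lambda>t. ln (p t n) - ln (p t 0)) = (\<lambda>t. (ln (p 0 n) - ln (p 0 0)) + (a n - a 0) * t)" for n
  proof
    show "ln (p t n) - ln (p t 0) = (ln (p 0 n) - ln (p 0 0)) + (a n - a 0) * t" for t
      using ln_p[of t n] ln_p[of t 0] by (simp add: algebra_simps)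
  qed
  moreover have "((\<lambda>t. (ln (p 0 n) - ln (p 0 0)) + (a n - a 0) * t) has_real_derivative a n - a 0)
      (at t)" for n t
    by (auto intro!: derivative_eq_intros)
  ultimately have "log_velocity p n t - log_velocity p 0 t = a n - a 0" for n t
    using DERIV_unique ln_ratio_deriv by metis
  then show "e_geodesic p"
    unfolding e_geodesic_iff_log_velocity by simp
qed

end

section \<open>Existence of global geodesics\<close>

text \<open>The candidate is the exponential family with \<lambda> = 0. Smoothness comes from
  projecting an exponential curve in \<open>ell2\<close> to the sphere, and tangency of
  \<open>v0\<close> yields the prescribed initial velocity.\<close>

lemma global_e_geodesic_exists_if_summable:
  assumes p0: "p0 \<in> prob_simplex" and v0: "v0 \<in> tangent_space p0"
    and summ: "\<And>t. summable (\<lambda>k. p0 k * exp (v0 k / p0 k * t))"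
  shows "global_e_geodesic_exists p0 v0"
proof -
  have pos: "0 < p0 n" for n
    using p0 by (simp add: prob_simplex_def)
  define b where "b = (\<lambda>n. v0 n / p0 n)"
  define w where "w = (\<lambda>n. sqrt (p0 n))"
  \<comment> \<open>The exponent is halved because \<open>Phi\<close> takes square roots: the
    squared coordinates of \<open>y\<close> are then the unnormalised p_n.\<close>
  define c where "c = (\<lambda>n. b n / 2)"
  define y where "y = exp_curve w c"
  define Z where "Z = (\<lambda>t. \<Sum>k. p0 k * exp (b k * t))"
  define p where "p = (\<lambda>t n. p0 n * exp (b n * t) / Z t)"
  have wc: "(w n)\<^sup>2 * exp (2 * c n * t) = p0 n * exp (b n * t)" for n t
    using pos[of n] by (simp add: w_def c_def)
  have summ': "summable (\<lambda>n. (w n)\<^sup>2 * exp (2 * c n * t))" for t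
    using summ by (simp add: wc) (simp add: b_def)
  have sumZ: "(\<lambda>k. p0 k * exp (b k * t)) sums Z t" for t
    using summ[of t] by (simp add: Z_def b_def summable_sums)
  have Zpos: "0 < Z t" for t
    unfolding Z_def by (intro suminf_pos) (use sumZ pos in \<open>auto simp: sums_iff\<close>)
  have seq_y: "seq_of (y t) n = w n * exp (c n * t)" for t n
    using summable_exp_sq[OF summ', of 0 t] by (simp add: y_def exp_curve_def seq_of_Abs_ell2)
  have y_sq: "(seq_of (y t) n)\<^sup>2 = p0 n * exp (b n * t)" for t n
    by (simp add: seq_y power_mult_distrib wc[symmetric] exp_double[symmetric] mult.assoc)
  have norm_y: "norm (y t) = sqrt (Z t)" for t
    using norm_ell2_sq[of "y t"] by (simp add: y_sq Z_def real_sqrt_unique)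
  have p_mem: "p t \<in> prob_simplex" for t
  proof -
    have "p t sums 1"
      using sums_divide[OF sumZ[of t], of "Z t"] Zpos[of t] by (simp add: p_def)
    moreover have "0 < p t n" for n
      using pos Zpos by (simp add: p_def)
    ultimately show ?thesis
      by (auto simp: prob_simplex_def sums_iff less_imp_le)
  qed
  have "Phi (p t) = sgn (y t)" for t
  proof -
    have "seq_of (Phi (p t)) n = seq_of (sgn (y t)) n" for n
    proof -
      have "0 \<le> seq_of (y t) n"
        using pos[of n] by (simp add: seq_y w_def)
      then have "sqrt (p0 n * exp (b n * t)) = seq_of (y t) n"
        by (simp flip: y_sq)
      then have "sqrt (p t n) = seq_of (y t) n / sqrt (Z t)"
        by (simp add: p_def real_sqrt_divide)
      then show ?thesis
        by (simp add: seq_of_Phi[OF p_mem] sgn_div_norm scaleR_ell2.rep_eq norm_y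
            divide_inverse_commute)
    qed
    then show ?thesis
      by (simp add: seq_of_inject[symmetric] fun_eq_iff)
  qed
  moreover have "smooth_curve y"
    unfolding y_def by (rule smooth_curve_exp_curve[OF summ'])
  moreover have "y t \<noteq> 0" for t
    using norm_y[of t] Zpos[of t] by auto
  ultimately have smooth: "smooth_simplex_curve p"
    using p_mem smooth_curve_sgn[of y] by (simp add: smooth_simplex_curve_def)
  have Z0: "Z 0 = 1"
    using p0 by (simp add: Z_def prob_simplex_def)
  then have p_0: "p 0 = p0"
    by (simp add: p_def fun_eq_iff)
  \<comment> \<open>Writing Z = |y|^2 replaces termwise differentiation of the series by Z'(0) = 2
    <y(0), y'(0)>, which is the sum of \<open>v0\<close> and vanishes by tangency.\<close>
  have Z_deriv: "(Z has_real_derivative 0) (at 0)"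
  proof -
    define y' where "y' = exp_curve (\<lambda>n. w n * c n) c 0"
    have y': "(y has_vector_derivative y') (at 0)"
      using exp_curve_has_vector_derivative[OF summ', of 0 0] by (simp add: y_def y'_def)
    have "seq_of y' n = w n * c n" for n
      using summable_exp_sq[OF summ', of 1 0] by (simp add: y'_def exp_curve_def seq_of_Abs_ell2)
    then have "seq_of (y 0) n * seq_of y' n = w n * w n * c n" for n
      by (simp add: seq_y)
    moreover have "w n * w n * c n = v0 n / 2" for n
      using pos[of n] by (simp add: w_def c_def b_def)
    ultimately have "inner (y 0) y' = (\<Sum>n. v0 n / 2)"
      by (simp only: inner_ell2.rep_eq)
    also have "\<dots> = 0"
      using v0 suminf_divide[of v0 2] by (simp add: tangent_space_def summable_rabs_cancel)
    finally have "inner (y 0) y' = 0" .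
    moreover have "Z = (\<lambda>t. inner (y t) (y t))"
      using Zpos by (auto simp: fun_eq_iff norm_y less_imp_le simp flip: power2_norm_eq_inner)
    ultimately show ?thesis
      using bounded_bilinear.has_vector_derivative[OF bounded_bilinear_inner y' y']
      by (simp add: has_real_derivative_iff_has_vector_derivative inner_commute)
  qed
  \<comment> \<open>Since Z(0) = 1 and Z'(0) = 0, the quotient rule leaves only the derivative of
    the numerator.\<close>
  have "((\<lambda>t. p t n) has_real_derivative v0 n) (at 0)" for n
  proof -
    have "((\<lambda>t. p0 n * exp (b n * t)) has_real_derivative v0 n) (at 0)"
      using pos[of n] by (auto intro!: derivative_eq_intros simp: b_def)
    from DERIV_divide[OF this Z_deriv] show ?thesis
      by (simp add: p_def Z0)
  qed
  then have vel: "velocity p 0 = v0"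
    by (simp add: velocity_def fun_eq_iff DERIV_imp_deriv)
  have "e_geodesic p"
    unfolding e_geodesic_iff_exponential[OF smooth]
    using sums_summable[OF sumZ]
    by (intro exI[of _ 0] exI[of _ b]) (simp add: vel p_0, simp add: b_def p_def Z_def)
  with p_0 vel show ?thesis
    unfolding global_e_geodesic_exists_def by blast
qed

text \<open>The exponential form gives convergence with the exponents shifted by some \<lambda>. For
  fixed t the factor exp (-\<lambda> t) does not depend on k, so multiplying by it removes the
  shift.\<close>

lemma summable_if_global_e_geodesic_exists:
  assumes "global_e_geodesic_exists p0 v0"
  shows "summable (\<lambda>k. p0 k * exp (v0 k / p0 k * t))"
proof -
  obtain p where p: "e_geodesic p" "p 0 = p0" "velocity p 0 = v0"
    using assms unfolding global_e_geodesic_exists_def by blast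
  then have "\<exists>(l::real) a. (\<forall>n. a n = v0 n / p0 n + l) \<and> (\<forall>t. summable (\<lambda>k. p0 k * exp (a k * t)))"
    using e_geodesic_iff_exponential[of p] unfolding e_geodesic_def by blast
  then obtain l :: real and a where "\<And>n. a n = v0 n / p0 n + l"
    and "\<And>t. summable (\<lambda>k. p0 k * exp (a k * t))"
    by blast
  then have "summable (\<lambda>k. p0 k * exp ((v0 k / p0 k + l) * t))"
    by simp
  then have "summable (\<lambda>k. p0 k * exp ((v0 k / p0 k + l) * t) * exp (- (l * t)))"
    by (rule summable_mult2)
  then show ?thesis
    by (simp add: mult.assoc mult_exp_exp distrib_right)
qed

theorem theorem3p5:
  shows "(\<forall>p p0 v0. smooth_simplex_curve p \<and> p0 \<in> prob_simplex \<and> v0 \<in> tangent_space p0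
        \<and> p 0 = p0 \<and> velocity p 0 = v0 \<longrightarrow>
      (e_geodesic p \<longleftrightarrow>
        (\<exists>(l::real) a. (\<forall>n. a n = velocity p 0 n / p 0 n + l) \<and>
          (\<forall>t. summable (\<lambda>k. p 0 k * exp (a k * t))) \<and>
          (\<forall>n t. p t n = p 0 n * exp (a n * t) / (\<Sum>k. p 0 k * exp (a k * t))))))
    \<and> (\<forall>p0\<in>prob_simplex. \<forall>v0\<in>tangent_space p0.
      global_e_geodesic_exists p0 v0 \<longleftrightarrow>
        (\<forall>t. summable (\<lambda>k. p0 k * exp (v0 k / p0 k * t))))"
proof (intro conjI allI ballI impI)
  fix p :: "real \<Rightarrow> nat \<Rightarrow> real" and p0 v0 :: "nat \<Rightarrow> real"
  assume "smooth_simplex_curve p \<and> p0 \<in> prob_simplex \<and> v0 \<in> tangent_space p0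
    \<and> p 0 = p0 \<and> velocity p 0 = v0"
  then show "e_geodesic p \<longleftrightarrow>
      (\<exists>(l::real) a. (\<forall>n. a n = velocity p 0 n / p 0 n + l) \<and>
        (\<forall>t. summable (\<lambda>k. p 0 k * exp (a k * t))) \<and>
        (\<forall>n t. p t n = p 0 n * exp (a n * t) / (\<Sum>k. p 0 k * exp (a k * t))))"
    by (intro e_geodesic_iff_exponential) (rule conjunct1)
next
  fix p0 v0 :: "nat \<Rightarrow> real"
  assume mem: "p0 \<in> prob_simplex" "v0 \<in> tangent_space p0"
  show "global_e_geodesic_exists p0 v0 \<longleftrightarrow>
      (\<forall>t. summable (\<lambda>k. p0 k * exp (v0 k / p0 k * t)))"
  proof
    show "\<forall>t. summable (\<lambda>k. p0 k * exp (v0 k / p0 k * t))"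
      if "global_e_geodesic_exists p0 v0"
      using that by (intro allI summable_if_global_e_geodesic_exists)
    show "global_e_geodesic_exists p0 v0"
      if "\<forall>t. summable (\<lambda>k. p0 k * exp (v0 k / p0 k * t))"
      using mem spec[OF that] by (rule global_e_geodesic_exists_if_summable)
  qed
qed

end
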